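(* Let $d_0,d_1\ge 1$, $d^*:=\min(d_0,d_1)$ and let $c>0$ be a constant. Let $A_0,C\in\mathbb{R}^{d_0\times d_0}$ be commuting symmetric positive semi-definite matrices with $\Sigma:=A_0+C$ invertible, let $B\in\mathbb{R}^{d_0\times d_0}$ be a symmetric matrix commuting with $\Sigma$, and let $x,\chi$ be independent random vectors, each distributed as $\hat x+\epsilon$ with $\hat x\sim\mathcal N(0,A_0)$ and $\epsilon\sim\mathcal N(0,C)$ independent. For $\kappa>0$ and $W\in\mathbb{R}^{d_1\times d_0}$ let $$L_{\mathrm{norm}}(W)=-\mathrm{Tr}[WBW^T]+\tfrac18\,\mathrm{Var}\big[\|W(x-\chi)\|^2\big]+\kappa\big(\mathbb{E}_x\|Wx\|^2-c\big)^2 .$$ Let $W_\kappa$ be a stationary point of $L_{\mathrm{norm}}$ at fixed $\kappa$. Then $$\lim_{\kappa\to\infty}W_\kappa^TW_\kappa=\tfrac12\,\Sigma^{-1}\left[B_M+\frac{2c-\mathrm{Tr}[\Sigma^{-1}B_M]}{d_M}\,\Sigma_M\right]\Sigma^{-1},$$ where $M$ is the mask associated with the stationary point and $d_M$ is the number of non-zero eigenvalues of $B'_M$ (mask, $B'$ and the subscript $M$ are defined in the context).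
   Context: A stationary point is a point at which the gradient with respect to $W$ vanishes. $\|\cdot\|$ is the Euclidean norm. $A_0$ is the data covariance, $C$ the augmentation-noise covariance, $\Sigma$ the covariance of the augmented data, and $B$ is a matrix determined by the self-supervised loss under consideration (for example $B=A_0$ for InfoNCE). For a stationary point $W$ put $\rho(W):=\mathrm{Tr}[W\Sigma W^T]$ and $B':=B+2\kappa(c-\rho(W))\Sigma$. Masking: let $Q$ be an orthogonal matrix whose columns form a common eigenbasis of $\Sigma$ and $B$ (hence also of $B'$). For $X=QDQ^T$ with $D$ diagonal and $M$ diagonal with entries in $\{0,1\}$, $X_M:=QMDQ^T$. Every stationary point $W$ has the form $W^TW=\tfrac12\Sigma^{-1}B'_M\Sigma^{-1}$ for some diagonal mask $M$ with entries in $\{0,1\}$ such that $M_{ii}=0$ if the $i$-th eigenvalue of $B'$ is negative and $M$ has at most $d^*$ nonzero entries; this $M$ is the mask associated with $W$. *)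

theory Defs
  imports "HOL-Analysis.Analysis" "HOL-Probability.Probability"
begin

definition symmetric_matrix :: "real^'n^'n \<Rightarrow> bool" where
  "symmetric_matrix A \<longleftrightarrow> transpose A = A"

definition psd_matrix :: "real^'n^'n \<Rightarrow> bool" where
  "psd_matrix A \<longleftrightarrow> symmetric_matrix A \<and> (\<forall>v. 0 \<le> v \<bullet> (A *v v))"

definition diagonal_matrix :: "real^'n^'n \<Rightarrow> bool" where
  "diagonal_matrix D \<longleftrightarrow> (\<forall>i j. i \<noteq> j \<longrightarrow> D $ i $ j = 0)"

text \<open>The law \<open>N(0, A)\<close>, where \<open>A\<close> may be singular: every linear functional of \<open>X\<close> is a centred
  univariate normal variable with variance \<open>u \<bullet> (A *v u)\<close>, which is the constant \<open>0\<close> if that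
  variance vanishes.\<close>

definition centred_gaussian :: "'a measure \<Rightarrow> ('a \<Rightarrow> real^'n) \<Rightarrow> real^'n^'n \<Rightarrow> bool" where
  "centred_gaussian P X A \<longleftrightarrow>
     X \<in> borel_measurable P \<and>
     (\<forall>u. if u \<bullet> (A *v u) = 0 then (AE \<omega> in P. u \<bullet> X \<omega> = 0)
          else distributed P lborel (\<lambda>\<omega>. u \<bullet> X \<omega>) (normal_density 0 (sqrt (u \<bullet> (A *v u)))))"

definition L_norm ::
  "'a measure \<Rightarrow> ('a \<Rightarrow> real^'n) \<Rightarrow> ('a \<Rightarrow> real^'n) \<Rightarrow> real^'n^'n \<Rightarrow> real \<Rightarrow> real \<Rightarrow> real^'n^'m \<Rightarrow> real"
where
  "L_norm P x \<xi> B c \<kappa> W =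
     - trace (W ** B ** transpose W)
     + 1/8 * prob_space.variance P (\<lambda>\<omega>. (norm (W *v (x \<omega> - \<xi> \<omega>)))\<^sup>2)
     + \<kappa> * (prob_space.expectation P (\<lambda>\<omega>. (norm (W *v x \<omega>))\<^sup>2) - c)\<^sup>2"

definition stationary_point :: "('v::real_inner \<Rightarrow> real) \<Rightarrow> 'v \<Rightarrow> bool" where
  "stationary_point L W \<longleftrightarrow> GDERIV L W :> 0"

definition rho :: "real^'n^'n \<Rightarrow> real^'n^'m \<Rightarrow> real" where
  "rho S W = trace (W ** S ** transpose W)"

definition Bprime :: "real^'n^'n \<Rightarrow> real^'n^'n \<Rightarrow> real \<Rightarrow> real \<Rightarrow> real^'n^'m \<Rightarrow> real^'n^'n" where
  "Bprime S B c \<kappa> W = B + (2 * \<kappa> * (c - rho S W)) *\<^sub>R S"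

definition common_eigenbasis :: "real^'n^'n \<Rightarrow> real^'n^'n \<Rightarrow> real^'n^'n \<Rightarrow> bool" where
  "common_eigenbasis Q S B \<longleftrightarrow>
     orthogonal_matrix Q \<and>
     (\<forall>i. \<exists>\<mu>. S *v column i Q = \<mu> *\<^sub>R column i Q) \<and>
     (\<forall>i. \<exists>\<mu>. B *v column i Q = \<mu> *\<^sub>R column i Q)"

text \<open>If \<open>Q\<close> is orthogonal and \<open>X = Q ** D ** transpose Q\<close>, then \<open>D = eigen_diag Q X\<close>; hence
  \<open>masked Q M X\<close> is \<open>Q ** M ** D ** transpose Q\<close>, and for a column eigenbasis \<open>Q\<close> of \<open>X\<close> the
  \<open>i\<close>-th eigenvalue of \<open>X\<close> is \<open>eigen_diag Q X $ i $ i\<close>.\<close>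

definition eigen_diag :: "real^'n^'n \<Rightarrow> real^'n^'n \<Rightarrow> real^'n^'n" where
  "eigen_diag Q X = transpose Q ** X ** Q"

definition masked :: "real^'n^'n \<Rightarrow> real^'n^'n \<Rightarrow> real^'n^'n \<Rightarrow> real^'n^'n" where
  "masked Q M X = Q ** M ** eigen_diag Q X ** transpose Q"

definition associated_mask ::
  "real^'n^'n \<Rightarrow> real^'n^'n \<Rightarrow> real^'n^'n \<Rightarrow> real \<Rightarrow> real \<Rightarrow> real^'n^'m \<Rightarrow> real^'n^'n \<Rightarrow> bool"
where
  "associated_mask Q S B c \<kappa> W M \<longleftrightarrow>
     diagonal_matrix M \<and> (\<forall>i. M $ i $ i \<in> {0, 1}) \<and>
     (\<forall>i. eigen_diag Q (Bprime S B c \<kappa> W) $ i $ i < 0 \<longrightarrow> M $ i $ i = 0) \<and>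
     card {i. M $ i $ i \<noteq> 0} \<le> min CARD('n) CARD('m) \<and>
     transpose W ** W =
       (1/2) *\<^sub>R (matrix_inv S ** masked Q M (Bprime S B c \<kappa> W) ** matrix_inv S)"

definition eigenspace :: "real^'n^'n \<Rightarrow> real \<Rightarrow> (real^'n) set" where
  "eigenspace A \<mu> = {v. A *v v = \<mu> *\<^sub>R v}"

text \<open>Eigenvalues are counted with (geometric) multiplicity.\<close>

definition num_nonzero_eigenvalues :: "real^'n^'n \<Rightarrow> nat" where
  "num_nonzero_eigenvalues A =
     (\<Sum>\<mu> | \<mu> \<noteq> 0 \<and> eigenspace A \<mu> \<noteq> {0}. dim (eigenspace A \<mu>))"

end

theory Submission
  imports Defs "HOL-Real_Asymp.Real_Asymp"
begin

text \<open>In the basis \<open>Q\<close> the mask equation is diagonal and determines \<open>W\<^sup>T W\<close> up to the one scalar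
  \<open>l = 2 * \<kappa> * (c - \<rho>(W))\<close>. Taking its trace against \<open>\<Sigma>\<close> gives a linear equation with solution
  \<open>l = \<kappa> * a / (1 + \<kappa> * n)\<close>, where \<open>a = 2 * c - Tr(\<Sigma>\<^sup>-\<^sup>1 B\<^sub>M)\<close> and \<open>n\<close> is the rank of the mask, so
  \<open>l\<close> tends to \<open>a / n\<close>. If \<open>a \<noteq> 0\<close>, no masked-in eigenvalue of \<open>B'\<close> vanishes for large \<open>\<kappa>\<close>, hence
  \<open>d\<^sub>M = n\<close>.\<close>

section \<open>Diagonal matrices and their orthogonal conjugates\<close>

definition diag_mat :: "('n \<Rightarrow> real) \<Rightarrow> real^'n^'n" where
  "diag_mat d = (\<chi> i j. if i = j then d i else 0)"

text \<open>The matrices \<Sigma>, B, B', their masked versions and \<open>transpose W ** W\<close>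
  all take this form for one common \<open>Q\<close>, so matrix identities between them reduce to
  scalar identities indexed by \<open>i\<close>.\<close>

definition conj_diag :: "real^'n^'n \<Rightarrow> ('n \<Rightarrow> real) \<Rightarrow> real^'n^'n" where
  "conj_diag Q d = Q ** diag_mat d ** transpose Q"

lemma diag_mat_mult_vec: "diag_mat d *v v = (\<chi> i. d i * v $ i)"
  by (simp add: diag_mat_def matrix_vector_mult_def vec_eq_iff if_distrib if_distribR cong: if_cong)

lemma mult_diag_mat: "X ** diag_mat d = (\<chi> i j. d j * X $ i $ j)"
  by (simp add: diag_mat_def matrix_matrix_mult_def vec_eq_iff if_distrib if_distribR mult.commute
      cong: if_cong)

lemma diag_mat_mult: "diag_mat d ** diag_mat e = diag_mat (\<lambda>i. d i * e i)"
  by (simp add: mult_diag_mat) (simp add: diag_mat_def vec_eq_iff mult.commute)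

lemma diagonal_matrix_eq_diag_mat: "diagonal_matrix D \<Longrightarrow> D = diag_mat (\<lambda>i. D $ i $ i)"
  by (simp add: diagonal_matrix_def diag_mat_def vec_eq_iff)

lemma diag_mat_one: "diag_mat (\<lambda>i. 1) = mat 1"
  by (simp add: diag_mat_def mat_def)

lemma orthogonal_matrix_cancel:
  assumes "orthogonal_matrix Q"
  shows "X ** transpose Q ** Q = X" "X ** Q ** transpose Q = X"
  using assms by (simp_all add: orthogonal_matrix_def flip: matrix_mul_assoc)

lemma conj_diag_mult:
  assumes "orthogonal_matrix Q"
  shows "conj_diag Q d ** conj_diag Q e = conj_diag Q (\<lambda>i. d i * e i)"
  by (simp add: conj_diag_def matrix_mul_assoc orthogonal_matrix_cancel[OF assms]
      flip: diag_mat_mult)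

text \<open>The entries are linear in \<open>d\<close>, which yields sums, scalings and limits
  entrywise.\<close>

lemma conj_diag_nth: "conj_diag Q d $ i $ j = (\<Sum>k\<in>UNIV. d k * Q $ i $ k * Q $ j $ k)"
  by (simp add: conj_diag_def mult_diag_mat) (simp add: matrix_matrix_mult_def transpose_def)

lemma conj_diag_add: "conj_diag Q d + conj_diag Q e = conj_diag Q (\<lambda>i. d i + e i)"
  by (simp add: vec_eq_iff conj_diag_nth distrib_right sum.distrib)

lemma conj_diag_scaleR: "a *\<^sub>R conj_diag Q d = conj_diag Q (\<lambda>i. a * d i)"
  by (simp add: vec_eq_iff conj_diag_nth sum_distrib_left mult.assoc)

lemma trace_conj_diag:
  assumes "orthogonal_matrix Q"
  shows "trace (conj_diag Q d) = sum d UNIV"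
proof -
  have "trace (conj_diag Q d) = trace (transpose Q ** Q ** diag_mat d)"
    unfolding conj_diag_def by (metis trace_mul_sym matrix_mul_assoc)
  also have "\<dots> = trace (diag_mat d)"
    using assms by (simp add: orthogonal_matrix_def)
  finally show ?thesis
    by (simp add: trace_def diag_mat_def)
qed

lemma conj_diag_one:
  assumes "orthogonal_matrix Q"
  shows "conj_diag Q (\<lambda>i. 1) = mat 1"
  using assms by (simp add: conj_diag_def diag_mat_one orthogonal_matrix_def)

lemma eigen_diag_conj_diag:
  assumes "orthogonal_matrix Q"
  shows "eigen_diag Q (conj_diag Q d) = diag_mat d"
  using assms
  by (simp add: eigen_diag_def conj_diag_def matrix_mul_assoc orthogonal_matrix_cancel[OF assms])
     (simp add: orthogonal_matrix_def)

lemma masked_conj_diag: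
  assumes "orthogonal_matrix Q"
  shows "masked Q (diag_mat m) (conj_diag Q d) = conj_diag Q (\<lambda>i. m i * d i)"
  by (simp add: masked_def eigen_diag_conj_diag[OF assms])
     (simp add: conj_diag_def flip: diag_mat_mult matrix_mul_assoc)

text \<open>For square matrices a one-sided inverse is two-sided, so the choice in
  \<open>matrix_inv\<close> has a witness, and inverses are unique.\<close>

lemma matrix_inv_eqI:
  fixes A B :: "real^'n^'n"
  assumes "A ** B = mat 1"
  shows "matrix_inv A = B"
proof -
  have "B ** A = mat 1"
    using assms by (simp add: matrix_left_right_inverse)
  with assms have "\<exists>X. A ** X = mat 1 \<and> X ** A = mat 1"
    by blast
  then have *: "A ** matrix_inv A = mat 1 \<and> matrix_inv A ** A = mat 1"
    unfolding matrix_inv_def by (rule someI_ex)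
  then have "matrix_inv A = matrix_inv A ** (A ** B)"
    using assms by simp
  also have "\<dots> = B"
    using * by (simp add: matrix_mul_assoc)
  finally show ?thesis .
qed

lemma matrix_inv_conj_diag:
  assumes "orthogonal_matrix Q" "\<And>i. s i \<noteq> 0"
  shows "matrix_inv (conj_diag Q s) = conj_diag Q (\<lambda>i. 1 / s i)"
  using assms by (intro matrix_inv_eqI) (simp add: conj_diag_mult conj_diag_one)

section \<open>Eigenbases, eigenspaces and eigenvalue counts\<close>

lemma eigenbasis_conj_diag:
  assumes Q: "orthogonal_matrix Q" and ev: "\<forall>i. \<exists>\<mu>. A *v column i Q = \<mu> *\<^sub>R column i Q"
  obtains d where "A = conj_diag Q d"
proof -
  obtain d where d: "\<And>i. A *v column i Q = d i *\<^sub>R column i Q"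
    using ev by metis
  \<comment> \<open>These are the eigenvector equations, read column by column.\<close>
  have "A ** Q = Q ** diag_mat d"
    unfolding mult_diag_mat using d
    by (simp add: vec_eq_iff matrix_matrix_mult_def matrix_vector_mult_def column_def)
  then have "A = conj_diag Q d"
    unfolding conj_diag_def by (metis orthogonal_matrix_cancel(2)[OF Q])
  then show ?thesis ..
qed

text \<open>A zero \<open>d i\<close> would put column \<open>i\<close> of \<open>Q\<close>, the
  nonzero vector \<open>Q *v axis i 1\<close>, into the kernel.\<close>

lemma invertible_conj_diag_nonzero:
  assumes Q: "orthogonal_matrix Q" and inv: "invertible (conj_diag Q d)"
  shows "d i \<noteq> 0"
proof
  assume "d i = 0"
  have "conj_diag Q d *v (Q *v axis i 1) = Q *v (diag_mat d *v axis i 1)"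
    by (simp add: conj_diag_def matrix_vector_mul_assoc orthogonal_matrix_cancel[OF Q])
  also have "diag_mat d *v axis i 1 = 0"
    using \<open>d i = 0\<close> by (simp add: diag_mat_mult_vec vec_eq_iff axis_def)
  finally have "conj_diag Q d *v (Q *v axis i 1) = 0"
    by simp
  then have "Q *v axis i 1 = 0"
    using inv by (metis invertible_def matrix_vector_mul_assoc matrix_vector_mul_lid
        matrix_vector_mult_0_right)
  then have "transpose Q *v (Q *v axis i 1) = 0"
    by simp
  then have "axis i 1 = (0 :: real^'a)"
    using Q by (simp add: matrix_vector_mul_assoc orthogonal_matrix_def)
  then show False
    by (simp add: axis_eq_0_iff)
qed

text \<open>In the coordinates \<open>v = Q *v w\<close> the eigenvector equation decouples into
  \<open>d i * w $ i = \<mu> * w $ i\<close>. The resulting coordinate subspace has a known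
  dimension.\<close>

lemma eigenspace_conj_diag:
  assumes Q: "orthogonal_matrix Q"
  shows "eigenspace (conj_diag Q d) \<mu> = (*v) Q ` {w. \<forall>i. i \<notin> {i. d i = \<mu>} \<longrightarrow> w $ i = 0}"
proof -
  have QQ: "Q *v (transpose Q *v v) = v" "transpose Q *v (Q *v v) = v" for v
    using Q by (simp_all add: matrix_vector_mul_assoc orthogonal_matrix_def
        del: transpose_matrix_vector)
  have *: "conj_diag Q d *v (Q *v w) = \<mu> *\<^sub>R (Q *v w) \<longleftrightarrow> (\<forall>i. d i \<noteq> \<mu> \<longrightarrow> w $ i = 0)" for w
  proof -
    have "conj_diag Q d *v (Q *v w) = Q *v (diag_mat d *v w)"
      by (simp add: conj_diag_def matrix_vector_mul_assoc orthogonal_matrix_cancel[OF Q])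
    moreover have "\<mu> *\<^sub>R (Q *v w) = Q *v (\<mu> *\<^sub>R w)"
      by (simp add: matrix_vector_mult_scaleR)
    ultimately have "conj_diag Q d *v (Q *v w) = \<mu> *\<^sub>R (Q *v w) \<longleftrightarrow> diag_mat d *v w = \<mu> *\<^sub>R w"
      by (metis QQ(2))
    also have "\<dots> \<longleftrightarrow> (\<forall>i. d i \<noteq> \<mu> \<longrightarrow> w $ i = 0)"
      by (auto simp: diag_mat_mult_vec vec_eq_iff)
    finally show ?thesis .
  qed
  show ?thesis
  proof (intro set_eqI iffI)
    fix v assume "v \<in> eigenspace (conj_diag Q d) \<mu>"
    then have "\<forall>i. d i \<noteq> \<mu> \<longrightarrow> (transpose Q *v v) $ i = 0"
      using *[of "transpose Q *v v"]
      by (simp add: eigenspace_def QQ del: transpose_matrix_vector)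
    then show "v \<in> (*v) Q ` {w. \<forall>i. i \<notin> {i. d i = \<mu>} \<longrightarrow> w $ i = 0}"
      by (intro image_eqI[of _ _ "transpose Q *v v"]) (auto simp: QQ simp del: transpose_matrix_vector)
  qed (auto simp: eigenspace_def *)
qed

lemma dim_eigenspace_conj_diag:
  assumes Q: "orthogonal_matrix Q"
  shows "dim (eigenspace (conj_diag Q d) \<mu>) = card {i. d i = \<mu>}"
proof -
  have "inj ((*v) Q)"
    using Q by (intro inj_on_inverseI[of _ "(*v) (transpose Q)"])
      (simp add: matrix_vector_mul_assoc orthogonal_matrix_def)
  then have "dim (eigenspace (conj_diag Q d) \<mu>)
      = dim {w :: real^'a. \<forall>i. i \<notin> {i. d i = \<mu>} \<longrightarrow> w $ i = 0}"
    unfolding eigenspace_conj_diag[OF Q]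
    by (intro dim_image_eq matrix_vector_mul_linear) (auto intro: inj_on_subset)
  also have "\<dots> = card {i. d i = \<mu>}"
    using dim_substandard_cart[where 'a=real, of "{i. d i = \<mu>}"] by (simp add: dim_vec_eq)
  finally show ?thesis .
qed

text \<open>The fibres of \<open>d\<close> over its nonzero values partition the indices with
  \<open>d i \<noteq> 0\<close>, and the size of each fibre is the dimension of an
  eigenspace.\<close>

lemma num_nonzero_eigenvalues_conj_diag:
  assumes Q: "orthogonal_matrix Q"
  shows "num_nonzero_eigenvalues (conj_diag Q d) = card {i. d i \<noteq> 0}"
proof -
  let ?E = "eigenspace (conj_diag Q d)"
  have ne: "?E \<mu> \<noteq> {0} \<longleftrightarrow> \<mu> \<in> range d" for \<mu>
  proof -
    have "0 \<in> ?E \<mu>"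
      by (simp add: eigenspace_def)
    then have "?E \<mu> \<noteq> {0} \<longleftrightarrow> dim (?E \<mu>) \<noteq> 0"
      by (auto simp: dim_eq_0)
    then show ?thesis
      by (auto simp: dim_eigenspace_conj_diag[OF Q])
  qed
  have "num_nonzero_eigenvalues (conj_diag Q d) = (\<Sum>\<mu> \<in> d ` {i. d i \<noteq> 0}. card {i. d i = \<mu>})"
    unfolding num_nonzero_eigenvalues_def dim_eigenspace_conj_diag[OF Q] ne
    by (rule sum.cong) auto
  also have "\<dots> = card (\<Union>\<mu> \<in> d ` {i. d i \<noteq> 0}. {i. d i = \<mu>})"
    by (rule card_UN_disjoint[symmetric]) auto
  also have "(\<Union>\<mu> \<in> d ` {i. d i \<noteq> 0}. {i. d i = \<mu>}) = {i. d i \<noteq> 0}"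
    by auto
  finally show ?thesis .
qed

lemma tendsto_conj_diag:
  assumes "\<And>i. ((\<lambda>k. f k i) \<longlongrightarrow> g i) F"
  shows "((\<lambda>k. conj_diag Q (f k)) \<longlongrightarrow> conj_diag Q g) F"
  by (intro vec_tendstoI) (auto simp: conj_diag_nth intro!: tendsto_intros assms)

section \<open>The multiplier as a function of \<kappa>\<close>

text \<open>The mask equation is implicit, since \<open>W\<close> also enters its right-hand side
  through \<open>rho\<close>. Solving for the multiplier removes \<open>W\<close>: only the mask and
  the spectra of \<Sigma> and B remain.\<close>

lemma multiplier_eq:
  fixes m b s :: "'n::finite \<Rightarrow> real" and W :: "real^'n^'m"
  assumes Q: "orthogonal_matrix Q" and s: "\<And>i. s i \<noteq> 0" and "\<kappa> > 0" and m: "\<And>i. m i \<ge> 0"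
  assumes W: "transpose W ** W = (1/2) *\<^sub>R (matrix_inv (conj_diag Q s) **
      masked Q (diag_mat m) (Bprime (conj_diag Q s) (conj_diag Q b) c \<kappa> W) **
      matrix_inv (conj_diag Q s))"
  shows "2 * \<kappa> * (c - rho (conj_diag Q s) W)
    = \<kappa> * (2 * c - (\<Sum>i\<in>UNIV. m i * b i / s i)) / (1 + \<kappa> * sum m UNIV)"
proof -
  define l where "l = 2 * \<kappa> * (c - rho (conj_diag Q s) W)"
  have "transpose W ** W = conj_diag Q (\<lambda>i. 1/2 * (1 / s i * (m i * (b i + l * s i)) * (1 / s i)))"
    unfolding W by (simp add: Bprime_def matrix_inv_conj_diag Q s masked_conj_diag conj_diag_mult
        conj_diag_add conj_diag_scaleR flip: l_def)
  \<comment> \<open>By cyclicity of the trace, \<open>rho\<close> sees \<open>W\<close> only through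
    \<open>transpose W ** W\<close>.\<close>
  moreover have "rho (conj_diag Q s) W = trace (transpose W ** W ** conj_diag Q s)"
    unfolding rho_def by (metis trace_mul_sym matrix_mul_assoc)
  ultimately have "rho (conj_diag Q s) W
      = (\<Sum>i\<in>UNIV. 1/2 * (1 / s i * (m i * (b i + l * s i)) * (1 / s i)) * s i)"
    by (simp only: conj_diag_mult[OF Q] trace_conj_diag[OF Q])
  also have "\<dots> = (\<Sum>i\<in>UNIV. 1/2 * (m i * b i / s i) + l/2 * m i)"
    using s by (intro sum.cong) (simp_all add: field_simps)
  also have "\<dots> = 1/2 * (\<Sum>i\<in>UNIV. m i * b i / s i) + l/2 * sum m UNIV"
    by (simp only: sum.distrib sum_distrib_left)
  finally have "l = 2 * \<kappa> * (c - (1/2 * (\<Sum>i\<in>UNIV. m i * b i / s i) + l/2 * sum m UNIV))"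
    unfolding l_def by simp
  then have "l * (1 + \<kappa> * sum m UNIV) = \<kappa> * (2 * c - (\<Sum>i\<in>UNIV. m i * b i / s i))"
    by (simp add: algebra_simps)
  moreover have "1 + \<kappa> * sum m UNIV > 0"
    using \<open>\<kappa> > 0\<close> m by (intro add_pos_nonneg mult_nonneg_nonneg sum_nonneg) auto
  ultimately show ?thesis
    unfolding l_def by (simp add: field_simps)
qed

text \<open>An eigenvalue \<open>b + l(\<kappa>) * s\<close> with nonconstant multiplier \<open>l(\<kappa>) = \<kappa> * a / (1 + \<kappa> * n)\<close> vanishes
  for at most one \<open>\<kappa>\<close>.\<close>

lemma eventually_shifted_nonzero:
  fixes a b s n :: real
  assumes "a \<noteq> 0" "s \<noteq> 0" "n \<ge> 0"
  shows "\<forall>\<^sub>F \<kappa> in at_top. b + \<kappa> * a / (1 + \<kappa> * n) * s \<noteq> 0"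
  \<comment> \<open>Clearing the denominator leaves \<open>b + \<kappa> * (b * n + a * s)\<close>,
    and the bound lies at or beyond its root. If the slope is zero, the quotient is 0 by convention
    and the bound is 0.\<close>
  using eventually_gt_at_top[of "max 0 (- b / (b * n + a * s))"]
proof eventually_elim
  case (elim \<kappa>)
  have "1 + \<kappa> * n > 0"
    using elim assms by (intro add_pos_nonneg mult_nonneg_nonneg) auto
  moreover have "b + \<kappa> * (b * n + a * s) \<noteq> 0"
  proof
    assume eq: "b + \<kappa> * (b * n + a * s) = 0"
    show False
    proof (cases "b * n + a * s = 0")
      case True
      \<comment> \<open>Zero slope forces \<open>b = 0\<close>, hence \<open>a * s = 0\<close>,
        against \<open>a \<noteq> 0\<close> and \<open>s \<noteq> 0\<close>.\<close>
      with eq assms show False by simp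
    next
      case False
      then have "\<kappa> = - b / (b * n + a * s)"
        using eq by (simp add: field_simps)
      with elim show False by simp
    qed
  qed
  ultimately show ?case
    by (simp add: field_simps)
qed

section \<open>The limit for a family of stationary points\<close>

text \<open>The mask is fixed along the family, but B' varies with \<kappa>;
  \<open>d\<^sub>M\<close> is therefore the value at which the eigenvalue count settles.\<close>

theorem theorem2:
  fixes A\<^sub>0 C \<Sigma> B Q M :: "real^'n^'n"
    and c :: real
    and P :: "'a measure" and x \<xi> :: "'a \<Rightarrow> real^'n"
    and N :: "'b measure" and xhat eps :: "'b \<Rightarrow> real^'n"
    and W :: "real \<Rightarrow> real^'n^'m"
  assumes "c > 0"
    and "psd_matrix A\<^sub>0" and "psd_matrix C" and "A\<^sub>0 ** C = C ** A\<^sub>0"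
    and "\<Sigma> = A\<^sub>0 + C" and "invertible \<Sigma>"
    and "symmetric_matrix B" and "B ** \<Sigma> = \<Sigma> ** B"
    and "prob_space N"
    and "centred_gaussian N xhat A\<^sub>0" and "centred_gaussian N eps C"
    and "prob_space.indep_var N borel xhat borel eps"
    and "prob_space P"
    and "prob_space.indep_var P borel x borel \<xi>"
    and "distr P borel x = distr N borel (\<lambda>\<omega>. xhat \<omega> + eps \<omega>)"
    and "distr P borel \<xi> = distr N borel (\<lambda>\<omega>. xhat \<omega> + eps \<omega>)"
    and "common_eigenbasis Q \<Sigma> B"
    and "\<forall>\<^sub>F \<kappa> in at_top.
           stationary_point (L_norm P x \<xi> B c \<kappa>) (W \<kappa>) \<and>
           associated_mask Q \<Sigma> B c \<kappa> (W \<kappa>) M"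
  shows "\<exists>d\<^sub>M. (\<forall>\<^sub>F \<kappa> in at_top.
                num_nonzero_eigenvalues (masked Q M (Bprime \<Sigma> B c \<kappa> (W \<kappa>))) = d\<^sub>M) \<and>
              ((\<lambda>\<kappa>. transpose (W \<kappa>) ** W \<kappa>) \<longlongrightarrow>
                (1/2) *\<^sub>R (matrix_inv \<Sigma> **
                  (masked Q M B +
                    ((2 * c - trace (matrix_inv \<Sigma> ** masked Q M B)) / real d\<^sub>M)
                      *\<^sub>R masked Q M \<Sigma>) **
                  matrix_inv \<Sigma>)) at_top"
proof -
  have Q: "orthogonal_matrix Q"
    using assms(17) by (simp add: common_eigenbasis_def)
  obtain s where S: "\<Sigma> = conj_diag Q s"
    using assms(17) eigenbasis_conj_diag unfolding common_eigenbasis_def by metis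
  obtain b where B: "B = conj_diag Q b"
    using assms(17) eigenbasis_conj_diag unfolding common_eigenbasis_def by metis
  have s: "s i \<noteq> 0" for i
    using invertible_conj_diag_nonzero[OF Q] assms(6) S by simp
  define m where "m = (\<lambda>i. M $ i $ i)"
  have ev: "\<forall>\<^sub>F \<kappa> in at_top. \<kappa> > 0 \<and> associated_mask Q \<Sigma> B c \<kappa> (W \<kappa>) M"
    using eventually_conj[OF eventually_gt_at_top[of 0] assms(18)] by eventually_elim auto
  \<comment> \<open>The shape of \<open>M\<close> does not depend on \<kappa>, so a single parameter
    value suffices to read it off.\<close>
  then obtain \<kappa>\<^sub>0 where "associated_mask Q \<Sigma> B c \<kappa>\<^sub>0 (W \<kappa>\<^sub>0) M"
    using eventually_happens'[OF trivial_limit_at_top_linorder] by blast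
  then have M: "M = diag_mat m" and m01: "m i = 0 \<or> m i = 1" for i
    by (auto simp: associated_mask_def m_def intro: diagonal_matrix_eq_diag_mat)
  have m0: "m i \<ge> 0" for i
    using m01[of i] by auto
  define n where "n = sum m UNIV"
  have n_card: "n = real (card {i. m i \<noteq> 0})"
  proof -
    have "n = (\<Sum>i | m i \<noteq> 0. m i)"
      unfolding n_def by (intro sum.mono_neutral_right) auto
    also have "\<dots> = (\<Sum>i | m i \<noteq> 0. 1)"
      using m01 by (intro sum.cong) auto
    finally show ?thesis by simp
  qed
  define a where "a = 2 * c - (\<Sum>i\<in>UNIV. m i * b i / s i)"
  define l where "l \<kappa> = \<kappa> * a / (1 + \<kappa> * n)" for \<kappa> :: real
  have l_eq: "\<forall>\<^sub>F \<kappa> in at_top. Bprime \<Sigma> B c \<kappa> (W \<kappa>) = conj_diag Q (\<lambda>i. b i + l \<kappa> * s i) \<and>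
      transpose (W \<kappa>) ** W \<kappa> = conj_diag Q (\<lambda>i. m i * (b i + l \<kappa> * s i) / (2 * (s i)\<^sup>2))"
    using ev
  proof eventually_elim
    case (elim \<kappa>)
    then have "2 * \<kappa> * (c - rho \<Sigma> (W \<kappa>)) = l \<kappa>"
      unfolding l_def a_def n_def S
      by (intro multiplier_eq[OF Q s]) (auto simp: associated_mask_def M S B m0)
    then have Bp: "Bprime \<Sigma> B c \<kappa> (W \<kappa>) = conj_diag Q (\<lambda>i. b i + l \<kappa> * s i)"
      by (simp add: Bprime_def) (simp add: S B conj_diag_add conj_diag_scaleR)
    moreover have "transpose (W \<kappa>) ** W \<kappa>
        = (1/2) *\<^sub>R (matrix_inv \<Sigma> ** masked Q M (Bprime \<Sigma> B c \<kappa> (W \<kappa>)) ** matrix_inv \<Sigma>)"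
      using elim by (simp add: associated_mask_def)
    ultimately show ?case
      by (simp add: S M matrix_inv_conj_diag Q s masked_conj_diag conj_diag_mult
          conj_diag_scaleR power2_eq_square mult.assoc)
  qed
  have num: "\<forall>\<^sub>F \<kappa> in at_top.
      num_nonzero_eigenvalues (masked Q M (Bprime \<Sigma> B c \<kappa> (W \<kappa>)))
        = card {i. m i * (b i + l \<kappa> * s i) \<noteq> 0}"
    using l_eq
    by eventually_elim
       (simp add: M masked_conj_diag[OF Q] num_nonzero_eigenvalues_conj_diag[OF Q])
  txt \<open>For \<open>a = 0\<close> the count may be smaller than the rank of the mask, but then it is irrelevant.\<close>
  obtain d where d: "\<forall>\<^sub>F \<kappa> in at_top. card {i. m i * (b i + l \<kappa> * s i) \<noteq> 0} = d"
    and da: "a = 0 \<or> real d = n"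
  proof (cases "a = 0")
    case True
    with that[of "card {i. m i * b i \<noteq> 0}"] show ?thesis
      by (simp add: l_def)
  next
    case False
    have "\<forall>\<^sub>F \<kappa> in at_top. \<forall>i. b i + l \<kappa> * s i \<noteq> 0"
      unfolding l_def using False s n_card
      by (intro eventually_all_finite allI eventually_shifted_nonzero) auto
    then have "\<forall>\<^sub>F \<kappa> in at_top. card {i. m i * (b i + l \<kappa> * s i) \<noteq> 0} = card {i. m i \<noteq> 0}"
      by eventually_elim simp
    with that n_card show ?thesis by blast
  qed
  have lim_i: "((\<lambda>\<kappa>. m i * (b i + l \<kappa> * s i) / (2 * (s i)\<^sup>2))
      \<longlongrightarrow> m i * (b i + a / real d * s i) / (2 * (s i)\<^sup>2)) at_top" for i
  \<comment> \<open>If \<open>a = 0\<close>, both \<open>l\<close> and \<open>a / real d\<close>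
    vanish, whatever \<open>d\<close> is, even 0. If \<open>m i = 0\<close>, both sides are 0.
    Otherwise index \<open>i\<close> is masked in, so \<open>n > 0\<close>, and
    \<open>real d = n\<close>.\<close>
  proof (cases "a = 0 \<or> m i = 0")
    case True
    then show ?thesis by (auto simp: l_def)
  next
    case False
    then have "n > 0"
      unfolding n_card by (auto simp: card_gt_0_iff)
    then have "(l \<longlongrightarrow> a / n) at_top"
      unfolding l_def by (real_asymp simp: divide_inverse)
    then have "(l \<longlongrightarrow> a / real d) at_top"
      using da False by simp
    then show ?thesis
      using s by (intro tendsto_intros) auto
  qed
  have lim_eq: "(1/2) *\<^sub>R (matrix_inv \<Sigma> **
                  (masked Q M B +
                    ((2 * c - trace (matrix_inv \<Sigma> ** masked Q M B)) / real d)
                      *\<^sub>R masked Q M \<Sigma>) **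
                  matrix_inv \<Sigma>)
      = conj_diag Q (\<lambda>i. m i * (b i + a / real d * s i) / (2 * (s i)\<^sup>2))"
  proof -
    have "2 * c - trace (matrix_inv \<Sigma> ** masked Q M B) = a"
      by (simp add: a_def S B M matrix_inv_conj_diag Q s masked_conj_diag conj_diag_mult
          trace_conj_diag)
    \<comment> \<open>The left side has exactly the form that the rules for \<open>conj_diag\<close>
      produce from the matrix expression, with \<open>e\<close> standing for
      \<open>a / real d\<close>.\<close>
    moreover have "1/2 * (1 / s i * (m i * b i + e * (m i * s i)) * (1 / s i))
        = m i * (b i + e * s i) / (2 * (s i)\<^sup>2)" for i e
      using s[of i] by (simp add: field_simps power2_eq_square)
    ultimately show ?thesis
      by (simp only: S B M matrix_inv_conj_diag[OF Q s] masked_conj_diag[OF Q]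
          conj_diag_mult[OF Q] conj_diag_add conj_diag_scaleR)
  qed
  show ?thesis
  proof (intro exI conjI)
    show "\<forall>\<^sub>F \<kappa> in at_top.
        num_nonzero_eigenvalues (masked Q M (Bprime \<Sigma> B c \<kappa> (W \<kappa>))) = d"
      using num d by eventually_elim simp
    \<comment> \<open>The closed form agrees with
      \<open>transpose (W \<kappa>) ** W \<kappa>\<close> only eventually, which is enough to
      transfer the limit.\<close>
    have "\<forall>\<^sub>F \<kappa> in at_top. conj_diag Q (\<lambda>i. m i * (b i + l \<kappa> * s i) / (2 * (s i)\<^sup>2))
        = transpose (W \<kappa>) ** W \<kappa>"
      using l_eq by eventually_elim simp
    then show "((\<lambda>\<kappa>. transpose (W \<kappa>) ** W \<kappa>) \<longlongrightarrow>
                (1/2) *\<^sub>R (matrix_inv \<Sigma> **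
                  (masked Q M B +
                    ((2 * c - trace (matrix_inv \<Sigma> ** masked Q M B)) / real d)
                      *\<^sub>R masked Q M \<Sigma>) **
                  matrix_inv \<Sigma>)) at_top"
      unfolding lim_eq by (rule Lim_transform_eventually[OF tendsto_conj_diag[OF lim_i]])
  qed
qed

end
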